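(* Let $n\ge1$ and let $\Delta^+$ be the set of positive roots of the root system of type $A_n$, with the root order, and let $\mathfrak X:\mathrm{AN}(\Delta^+)\to\mathrm{AN}(\Delta^+)$ be its reverse operator. Then the OY-number $\mathcal Y$ is $\mathfrak X$-invariant: $\mathcal Y(\Gamma)=\mathcal Y(\mathfrak X(\Gamma))$ for every antichain $\Gamma\in\mathrm{AN}(\Delta^+)$.
   Context: Write $\Delta^+=\{\varepsilon_i-\varepsilon_{j+1}\mid 1\le i\le j\le n\}$ with simple roots $\alpha_i=\varepsilon_i-\varepsilon_{i+1}$; the root order is $x\preccurlyeq y$ iff $y-x$ is a non-negative integral combination of simple roots. An antichain is a set of mutually incomparable roots (including $\varnothing$); $\mathrm{AN}(\Delta^+)$ is the set of antichains. For $\Gamma$ an antichain, $\mathcal I(\Gamma)=\{x\in\Delta^+\mid\exists\gamma\in\Gamma,\ \gamma\preccurlyeq x\}$; for a subset $S$, $S_{min},S_{max}$ are its minimal/maximal elements. The reverse operator is $\mathfrak X(\Gamma)=(\Delta^+\setminus\mathcal I(\Gamma))_{max}$. OY-number: for a non-empty antichain $\Gamma=\{\gamma_1,\dots,\gamma_k\}$ with $\mathcal I=\mathcal I(\Gamma)$, set $r_\Gamma(\gamma_s)=\#(\mathcal I\setminus\{\gamma_s\})_{min}-\#\mathcal I_{min}+1$ and $\mathcal Y(\Gamma)=\sum_{s=1}^k r_\Gamma(\gamma_s)$; set $\mathcal Y(\varnothing)=0$. *)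

theory Defs
  imports Complex_Main
begin

text \<open>Vectors of Euclidean $(n+1)$-space are functions on the indices, with coordinates
  $1, \dots, n+1$ in use and all others zero.\<close>

definition eps :: "nat \<Rightarrow> nat \<Rightarrow> real" where
  "eps i = (\<lambda>k. if k = i then 1 else 0)"

definition simple_root :: "nat \<Rightarrow> nat \<Rightarrow> real" where
  "simple_root i = (\<lambda>k. eps i k - eps (i + 1) k)"

definition pos_roots :: "nat \<Rightarrow> (nat \<Rightarrow> real) set" where
  "pos_roots n = {(\<lambda>k. eps i k - eps (j + 1) k) | i j. 1 \<le> i \<and> i \<le> j \<and> j \<le> n}"

definition root_le :: "nat \<Rightarrow> (nat \<Rightarrow> real) \<Rightarrow> (nat \<Rightarrow> real) \<Rightarrow> bool" where
  "root_le n x y \<longleftrightarrow>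
    (\<exists>c :: nat \<Rightarrow> nat. \<forall>k. y k - x k = (\<Sum>i = 1..n. real (c i) * simple_root i k))"

definition antichains :: "nat \<Rightarrow> (nat \<Rightarrow> real) set set" where
  "antichains n = {\<Gamma>. \<Gamma> \<subseteq> pos_roots n \<and>
     (\<forall>x\<in>\<Gamma>. \<forall>y\<in>\<Gamma>. x \<noteq> y \<longrightarrow> \<not> root_le n x y \<and> \<not> root_le n y x)}"

definition upper_ideal :: "nat \<Rightarrow> (nat \<Rightarrow> real) set \<Rightarrow> (nat \<Rightarrow> real) set" where
  "upper_ideal n \<Gamma> = {x \<in> pos_roots n. \<exists>\<gamma>\<in>\<Gamma>. root_le n \<gamma> x}"

definition min_elems :: "nat \<Rightarrow> (nat \<Rightarrow> real) set \<Rightarrow> (nat \<Rightarrow> real) set" where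
  "min_elems n S = {x \<in> S. \<forall>y\<in>S. root_le n y x \<longrightarrow> y = x}"

definition max_elems :: "nat \<Rightarrow> (nat \<Rightarrow> real) set \<Rightarrow> (nat \<Rightarrow> real) set" where
  "max_elems n S = {x \<in> S. \<forall>y\<in>S. root_le n x y \<longrightarrow> y = x}"

definition reverse_op :: "nat \<Rightarrow> (nat \<Rightarrow> real) set \<Rightarrow> (nat \<Rightarrow> real) set" where
  "reverse_op n \<Gamma> = max_elems n (pos_roots n - upper_ideal n \<Gamma>)"

text \<open>Integer-valued, because the difference of cardinalities may be negative.\<close>

definition OY_r :: "nat \<Rightarrow> (nat \<Rightarrow> real) set \<Rightarrow> (nat \<Rightarrow> real) \<Rightarrow> int" where
  "OY_r n \<Gamma> \<gamma> =
     int (card (min_elems n (upper_ideal n \<Gamma> - {\<gamma>}))) - int (card (min_elems n (upper_ideal n \<Gamma>))) + 1"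

definition OY_number :: "nat \<Rightarrow> (nat \<Rightarrow> real) set \<Rightarrow> int" where
  "OY_number n \<Gamma> = (if \<Gamma> = {} then 0 else (\<Sum>\<gamma>\<in>\<Gamma>. OY_r n \<Gamma> \<gamma>))"

text \<open>All sums and cardinalities above are over finite sets.\<close>

lemma finite_pos_roots: "finite (pos_roots n)"
proof -
  have "pos_roots n \<subseteq> (\<lambda>(i, j) k. eps i k - eps (j + 1) k) ` ({1..n} \<times> {1..n})"
    unfolding pos_roots_def by force
  then show ?thesis
    by (rule finite_subset) simp
qed

lemma reverse_op_antichain: "reverse_op n \<Gamma> \<in> antichains n"
  unfolding reverse_op_def max_elems_def antichains_def by auto

end

theory Submission imports Defs begin

text \<open>
  The root with end points $i \le j$ is the interval $[i,j]$, and the root order is inclusion. Let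
  $A$ and $B$ be the sets of left and right end points of the antichain. Deleting $[i,j]$ from
  the ideal can only create the new minimal elements $[i-1,j]$ and $[i,j+1]$, so the OY-number
  counts the $i \in A$ with $i-1 \notin A \cup \{0\}$ and the $j \in B$ with
  $j+1 \notin B \cup \{n+1\}$.

  Adjoin the intervals $[0,0]$ and $[n+1,n+1]$ to the antichain, and let $D$ be the set of $m$ with
  $[m,m]$ in this extension. Consecutive elements $[i,j]$, $[i',j']$ of it
  yield $[i+1,j'-1]$ in the reversed antichain, except when both are one-point intervals
  $[m,m]$, $[m+1,m+1]$. Because of this exception the count over $A$ loses the points at which a
  run of at least two elements of $D$ begins and gains those at which such a run ends; the count
  over $B$ changes the other way round.
\<close>

section \<open>Roots as intervals\<close>

definition root_of :: "nat \<times> nat \<Rightarrow> nat \<Rightarrow> real" where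
  "root_of p = (\<lambda>k. eps (fst p) k - eps (snd p + 1) k)"

definition intervals :: "nat \<Rightarrow> (nat \<times> nat) set" where
  "intervals n = {(i, j). 1 \<le> i \<and> i \<le> j \<and> j \<le> n}"

definition int_le :: "nat \<times> nat \<Rightarrow> nat \<times> nat \<Rightarrow> bool" where
  "int_le p q \<longleftrightarrow> fst q \<le> fst p \<and> snd p \<le> snd q"

definition int_antichain :: "(nat \<times> nat) set \<Rightarrow> bool" where
  "int_antichain G \<longleftrightarrow> (\<forall>p\<in>G. \<forall>q\<in>G. int_le p q \<longrightarrow> p = q)"

definition int_ideal :: "nat \<Rightarrow> (nat \<times> nat) set \<Rightarrow> (nat \<times> nat) set" where
  "int_ideal n G = {q \<in> intervals n. \<exists>p\<in>G. int_le p q}"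

definition int_min :: "(nat \<times> nat) set \<Rightarrow> (nat \<times> nat) set" where
  "int_min S = {p \<in> S. \<forall>q\<in>S. int_le q p \<longrightarrow> q = p}"

definition int_max :: "(nat \<times> nat) set \<Rightarrow> (nat \<times> nat) set" where
  "int_max S = {p \<in> S. \<forall>q\<in>S. int_le p q \<longrightarrow> q = p}"

definition int_reverse :: "nat \<Rightarrow> (nat \<times> nat) set \<Rightarrow> (nat \<times> nat) set" where
  "int_reverse n G = int_max (intervals n - int_ideal n G)"

lemma finite_intervals: "finite (intervals n)"
  by (rule finite_subset[of _ "{1..n} \<times> {1..n}"]) (auto simp: intervals_def)

lemma pos_roots_eq_image: "pos_roots n = root_of ` intervals n"
  unfolding pos_roots_def intervals_def root_of_def by force

section \<open>The root order as inclusion of intervals\<close>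

lemma root_eq_sum_simple_roots:
  assumes "p \<in> intervals n"
  shows "root_of p k = (\<Sum>l = 1..n. of_bool (fst p \<le> l \<and> l \<le> snd p) * simple_root l k)"
proof -
  obtain i j where p: "p = (i, j)" "1 \<le> i" "i \<le> j" "j \<le> n"
    using assms by (auto simp: intervals_def)
  have "(\<Sum>l = 1..n. of_bool (i \<le> l \<and> l \<le> j) * simple_root l k) = (\<Sum>l\<in>{i..j}. simple_root l k)"
    using p by (intro sum.mono_neutral_cong_right) auto
  also have "\<dots> = - (\<Sum>l = i..j. eps (Suc l) k - eps l k)"
    by (simp add: simple_root_def sum_negf[symmetric])
  also have "\<dots> = eps i k - eps (j + 1) k"
    using p by (subst sum_Suc_diff) auto
  finally show ?thesis
    using p by (simp add: root_of_def)
qed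

text \<open>Summing the coordinates up to \<open>m\<close> is the linear functional dual to the
  simple root of index \<open>m\<close>, as \<open>sum_simple_root\<close> shows. On a root it
  therefore reads off one coefficient.\<close>

lemma sum_root:
  assumes "p \<in> intervals n"
  shows "(\<Sum>k\<le>m. root_of p k) = of_bool (fst p \<le> m \<and> m \<le> snd p)"
  using assms by (auto simp: root_of_def eps_def intervals_def sum_subtractf)

lemma sum_simple_root: "(\<Sum>k\<le>m. simple_root l k) = of_bool (l = m)"
  by (auto simp: simple_root_def eps_def sum_subtractf)

lemma root_le_iff:
  assumes p: "p \<in> intervals n" and q: "q \<in> intervals n"
  shows "root_le n (root_of p) (root_of q) \<longleftrightarrow> int_le p q"
proof
  assume "root_le n (root_of p) (root_of q)"
  then obtain c :: "nat \<Rightarrow> nat" where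
    c: "\<And>k. root_of q k - root_of p k = (\<Sum>i = 1..n. real (c i) * simple_root i k)"
    unfolding root_le_def by blast
  have *: "of_bool (fst p \<le> m \<and> m \<le> snd p) \<le> (of_bool (fst q \<le> m \<and> m \<le> snd q) :: real)" for m
  proof -
    have "(\<Sum>k\<le>m. root_of q k) - (\<Sum>k\<le>m. root_of p k) = (\<Sum>k\<le>m. \<Sum>i = 1..n. real (c i) * simple_root i k)"
      by (simp add: c flip: sum_subtractf)
    also have "\<dots> = (\<Sum>i = 1..n. real (c i) * (\<Sum>k\<le>m. simple_root i k))"
      by (subst sum.swap) (simp add: sum_distrib_left)
    also have "\<dots> \<ge> 0"
      by (simp add: sum_simple_root sum_nonneg)
    finally show ?thesis
      unfolding sum_root[OF p] sum_root[OF q] by simp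
  qed
  \<comment> \<open>Both end points of \<open>p\<close> have coefficient 1 in \<open>p\<close>,
    hence in \<open>q\<close>, so both lie in \<open>q\<close>.\<close>
  from *[of "fst p"] *[of "snd p"] p show "int_le p q"
    by (auto simp: int_le_def intervals_def of_bool_def split: if_splits)
next
  assume le: "int_le p q"
  \<comment> \<open>The indicator of the points of \<open>q\<close> outside \<open>p\<close>.
    Inclusion makes the truncated subtraction exact.\<close>
  define c :: "nat \<Rightarrow> nat" where
    "c l = of_bool (fst q \<le> l \<and> l \<le> snd q) - of_bool (fst p \<le> l \<and> l \<le> snd p)" for l
  have "real (c l) = of_bool (fst q \<le> l \<and> l \<le> snd q) - of_bool (fst p \<le> l \<and> l \<le> snd p)" for l
    using le by (auto simp: c_def int_le_def)
  then have "\<forall>k. root_of q k - root_of p k = (\<Sum>l = 1..n. real (c l) * simple_root l k)"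
    by (simp add: root_eq_sum_simple_roots[OF p] root_eq_sum_simple_roots[OF q]
        left_diff_distrib sum_subtractf)
  then show "root_le n (root_of p) (root_of q)"
    unfolding root_le_def by blast
qed

lemma int_le_refl: "int_le p p"
  by (simp add: int_le_def)

lemma int_le_trans: "int_le p q \<Longrightarrow> int_le q r \<Longrightarrow> int_le p r"
  by (simp add: int_le_def)

lemma int_le_antisym: "int_le p q \<Longrightarrow> int_le q p \<Longrightarrow> p = q"
  by (simp add: int_le_def prod_eq_iff)

text \<open>If two roots are equal, reflexivity of inclusion makes them comparable both ways, and
  antisymmetry on intervals applies.\<close>

lemma inj_on_root: "inj_on root_of (intervals n)"
  by (metis inj_onI int_le_antisym int_le_refl root_le_iff)

lemma root_eq_iff:
  "p \<in> intervals n \<Longrightarrow> q \<in> intervals n \<Longrightarrow> root_of p = root_of q \<longleftrightarrow> p = q"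
  using inj_on_root by (auto dest: inj_onD)

section \<open>Ideals, extremal elements and the reverse operator on intervals\<close>

lemma upper_ideal_root:
  assumes "G \<subseteq> intervals n"
  shows "upper_ideal n (root_of ` G) = root_of ` int_ideal n G"
proof -
  have [simp]: "p \<in> intervals n" if "p \<in> G" for p using that assms by blast
  show ?thesis
    unfolding upper_ideal_def int_ideal_def pos_roots_eq_image
    by (auto simp: root_le_iff intro!: imageI)
qed

lemma min_elems_root:
  assumes "S \<subseteq> intervals n"
  shows "min_elems n (root_of ` S) = root_of ` int_min S"
proof -
  have [simp]: "p \<in> intervals n" if "p \<in> S" for p using that assms by blast
  show ?thesis
    unfolding min_elems_def int_min_def
    by (auto simp: root_le_iff root_eq_iff[of _ n] intro!: imageI)
qed

lemma max_elems_root: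
  assumes "S \<subseteq> intervals n"
  shows "max_elems n (root_of ` S) = root_of ` int_max S"
proof -
  have [simp]: "p \<in> intervals n" if "p \<in> S" for p using that assms by blast
  show ?thesis
    unfolding max_elems_def int_max_def
    by (auto simp: root_le_iff root_eq_iff[of _ n] intro!: imageI)
qed

lemma root_image_diff:
  assumes "S \<subseteq> intervals n" "T \<subseteq> intervals n"
  shows "root_of ` S - root_of ` T = root_of ` (S - T)"
  using inj_on_image_set_diff[OF inj_on_root[of n], of S T] assms by blast

lemma card_root_image: "S \<subseteq> intervals n \<Longrightarrow> card (root_of ` S) = card S"
  by (meson card_image inj_on_root inj_on_subset)

lemma int_ideal_subset: "int_ideal n G \<subseteq> intervals n"
  by (auto simp: int_ideal_def)

lemma int_min_subset: "int_min S \<subseteq> S"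
  by (auto simp: int_min_def)

lemma int_reverse_subset: "int_reverse n G \<subseteq> intervals n"
  by (auto simp: int_reverse_def int_max_def)

lemma reverse_op_root:
  assumes "G \<subseteq> intervals n"
  shows "reverse_op n (root_of ` G) = root_of ` int_reverse n G"
  unfolding reverse_op_def int_reverse_def
  by (simp add: upper_ideal_root[OF assms] pos_roots_eq_image
      root_image_diff[OF order_refl int_ideal_subset] max_elems_root)

lemma antichains_root:
  assumes "\<Gamma> \<in> antichains n"
  obtains G where "G \<subseteq> intervals n" "int_antichain G" "\<Gamma> = root_of ` G"
proof -
  obtain G where G: "G \<subseteq> intervals n" "\<Gamma> = root_of ` G"
    using assms by (auto simp: antichains_def pos_roots_eq_image subset_image_iff)
  have [simp]: "p \<in> intervals n" if "p \<in> G" for p using that G(1) by blast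
  have "int_antichain G"
    unfolding int_antichain_def
  proof (intro ballI impI)
    fix p q assume pq: "p \<in> G" "q \<in> G" "int_le p q"
    then have "root_le n (root_of p) (root_of q)" by (simp add: root_le_iff)
    then have "root_of p = root_of q"
      using assms pq G(2) by (auto simp: antichains_def)
    then show "p = q" using pq by (simp add: root_eq_iff[of _ n])
  qed
  with G that show ?thesis by blast
qed

lemma int_antichain_reverse: "int_antichain (int_reverse n G)"
  by (auto simp: int_antichain_def int_reverse_def int_max_def)

section \<open>The OY-number in terms of end points\<close>

text \<open>Every member of the ideal lies above an element of \<open>G\<close>, and no element of
  \<open>G\<close> lies above another. Hence \<open>card G\<close> is the term subtracted in
  \<open>OY_r\<close>.\<close>

lemma int_min_ideal:
  assumes "G \<subseteq> intervals n" "int_antichain G"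
  shows "int_min (int_ideal n G) = G"
proof -
  have sub: "G \<subseteq> int_ideal n G"
    using assms(1) by (auto simp: int_ideal_def intro: int_le_refl)
  have "q = p" if p: "p \<in> G" and q: "q \<in> int_ideal n G" "int_le q p" for p q
  proof -
    obtain r where r: "r \<in> G" "int_le r q" using q by (auto simp: int_ideal_def)
    then have "r = p" using int_le_trans[OF r(2) q(2)] p assms(2) by (auto simp: int_antichain_def)
    then show ?thesis using r q int_le_antisym by blast
  qed
  moreover have "p \<in> G" if "p \<in> int_min (int_ideal n G)" for p
    using that sub by (force simp: int_min_def int_ideal_def)
  ultimately show ?thesis using sub by (auto simp: int_min_def)
qed

text \<open>Mostly used in contraposed form: along an antichain, left and right end points increase
  together.\<close>

lemma antichain_eq:
  assumes "int_antichain G" "(i, j) \<in> G" "(a, b) \<in> G" "a \<le> i" "j \<le> b"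
  shows "a = i" "b = j"
  using assms by (force simp: int_antichain_def int_le_def)+

text \<open>The candidates are the two intervals covering \<open>(i, j)\<close>. The first fails to
  be minimal exactly when it leaves the range or contains another element of \<open>G\<close>; by
  the antichain property such an element is one that starts at \<open>i - 1\<close>. The second is
  symmetric. Each set on the right is empty or a singleton.\<close>

lemma int_min_ideal_remove:
  assumes G: "G \<subseteq> intervals n" "int_antichain G" and g: "(i, j) \<in> G"
  shows "int_min (int_ideal n G - {(i, j)}) = (G - {(i, j)})
    \<union> {p. p = (i - 1, j) \<and> i - 1 \<notin> insert 0 (fst ` G)}
    \<union> {p. p = (i, j + 1) \<and> j + 1 \<notin> insert (n + 1) (snd ` G)}" (is "?L = ?R")
proof
  have ij: "1 \<le> i" "i \<le> j" "j \<le> n" using G g by (auto simp: intervals_def)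
  have sub: "x \<in> int_ideal n G" if "x \<in> G" for x
    using that G by (auto simp: int_ideal_def intro: int_le_refl)
  note eqs = antichain_eq[OF G(2)]
  show "?L \<subseteq> ?R"
  proof
    fix p assume pL: "p \<in> ?L"
    obtain a b where p: "p = (a, b)" by force
    have ab: "1 \<le> a" "a \<le> b" "b \<le> n"
      using pL p by (auto simp: int_min_def int_ideal_def intervals_def)
    have min: "q = p" if "q \<in> int_ideal n G" "q \<noteq> (i, j)" "int_le q p" for q
      using pL that by (auto simp: int_min_def)
    show "p \<in> ?R"
    proof (cases "\<exists>q\<in>G - {(i, j)}. int_le q p")
      case True
      then obtain q where q: "q \<in> G - {(i, j)}" "int_le q p" by blast
      with min[of q] sub show ?thesis by auto
    next
      case False
      moreover obtain q where "q \<in> G" "int_le q p"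
        using pL by (auto simp: int_min_def int_ideal_def)
      ultimately have "int_le (i, j) p" by auto
      then have le: "a \<le> i" "j \<le> b" by (auto simp: p int_le_def)
      have ne: "p \<noteq> (i, j)" using pL by (auto simp: int_min_def)
      have no: "c < a \<or> b < d" if "(c, d) \<in> G" "(c, d) \<noteq> (i, j)" for c d
        using False that p by (force simp: int_le_def)
      consider "a < i" | "a = i" "j < b" using le ne p by force
      then show ?thesis
      proof cases
        case 1
        \<comment> \<open>This interval lies in the ideal, differs from \<open>(i, j)\<close> and is
          contained in \<open>p\<close>, so minimality of \<open>p\<close> forces equality.\<close>
        then have "(i - 1, j) = p"
          using ij ab le p g
          by (intro min) (auto simp: int_ideal_def intervals_def int_le_def intro!: bexI[of _ "(i, j)"])
        moreover have "i - 1 \<notin> fst ` G"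
        proof
          assume "i - 1 \<in> fst ` G"
          then obtain d where d: "(i - 1, d) \<in> G" by force
          then have "d < j" using eqs(1)[OF g d] ij by linarith
          then show False using no[OF d] \<open>(i - 1, j) = p\<close> p by auto
        qed
        ultimately show ?thesis using p ab by auto
      next
        case 2
        then have "(i, j + 1) = p"
          using ij ab le p g
          by (intro min) (auto simp: int_ideal_def intervals_def int_le_def intro!: bexI[of _ "(i, j)"])
        moreover have "j + 1 \<notin> snd ` G"
        proof
          assume "j + 1 \<in> snd ` G"
          then obtain c where c: "(c, j + 1) \<in> G" by force
          then have "i < c" using eqs(2)[OF g c] by linarith
          then show False using no[OF c] \<open>(i, j + 1) = p\<close> p by auto
        qed
        ultimately show ?thesis using p ab by auto
      qed
    qed
  qed
  show "?R \<subseteq> ?L"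
  proof
    fix p assume "p \<in> ?R"
    then consider "p \<in> G - {(i, j)}" | "p = (i - 1, j)" "i - 1 \<noteq> 0" "i - 1 \<notin> fst ` G"
      | "p = (i, j + 1)" "j + 1 \<noteq> n + 1" "j + 1 \<notin> snd ` G" by auto
    then show "p \<in> ?L"
    proof cases
      case 1
      then have "p \<in> int_min (int_ideal n G)" by (simp add: int_min_ideal G)
      with 1 show ?thesis by (auto simp: int_min_def)
    next
      case 2
      have "p \<in> int_ideal n G - {(i, j)}"
        using 2 ij g
        by (auto simp: int_ideal_def intervals_def int_le_def intro!: bexI[of _ "(i, j)"])
      moreover have "q = p" if q: "q \<in> int_ideal n G" "q \<noteq> (i, j)" "int_le q p" for q
      proof -
        \<comment> \<open>An element of \<open>G\<close> inside \<open>q\<close> does not start at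
          \<open>i - 1\<close>, so it lies in \<open>(i, j)\<close> and equals it. Then
          \<open>q\<close> is squeezed between \<open>(i, j)\<close> and its cover.\<close>
        obtain c d where cd: "(c, d) \<in> G" "int_le (c, d) q"
          using q by (auto simp: int_ideal_def)
        then have "i - 1 \<le> c" "d \<le> j" using 2 q by (auto simp: int_le_def)
        moreover have "c \<noteq> i - 1" using 2 cd by force
        ultimately have "i \<le> c" "d \<le> j" by linarith+
        then have "c = i" "d = j" using eqs[OF cd(1) g] by auto
        with cd q 2 show ?thesis by (cases q) (auto simp: int_le_def)
      qed
      ultimately show ?thesis by (auto simp: int_min_def)
    next
      case 3
      have "p \<in> int_ideal n G - {(i, j)}"
        using 3 ij g
        by (auto simp: int_ideal_def intervals_def int_le_def intro!: bexI[of _ "(i, j)"])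
      moreover have "q = p" if q: "q \<in> int_ideal n G" "q \<noteq> (i, j)" "int_le q p" for q
      proof -
        obtain c d where cd: "(c, d) \<in> G" "int_le (c, d) q"
          using q by (auto simp: int_ideal_def)
        then have "i \<le> c" "d \<le> j + 1" using 3 q by (auto simp: int_le_def)
        moreover have "d \<noteq> j + 1" using 3 cd by force
        ultimately have "i \<le> c" "d \<le> j" by linarith+
        then have "c = i" "d = j" using eqs[OF cd(1) g] by auto
        with cd q 3 show ?thesis by (cases q) (auto simp: int_le_def)
      qed
      ultimately show ?thesis by (auto simp: int_min_def)
    qed
  qed
qed

text \<open>The summand 1 in \<open>OY_r\<close> makes up for the deleted element, so what remains
  is the number of new minimal elements.\<close>

lemma OY_r_root:
  assumes G: "G \<subseteq> intervals n" "int_antichain G" and g: "(i, j) \<in> G"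
  shows "OY_r n (root_of ` G) (root_of (i, j)) =
    of_bool (i - 1 \<notin> insert 0 (fst ` G)) + of_bool (j + 1 \<notin> insert (n + 1) (snd ` G))"
proof -
  have fin: "finite G" using G(1) finite_intervals finite_subset by blast
  have gi: "(i, j) \<in> intervals n" using G g by blast
  then have ij: "1 \<le> i" "i \<le> j" "j \<le> n" by (auto simp: intervals_def)
  define U where "U = {p. p = (i - 1, j) \<and> i - 1 \<notin> insert 0 (fst ` G)}"
  define V where "V = {p. p = (i, j + 1) \<and> j + 1 \<notin> insert (n + 1) (snd ` G)}"
  have cards: "card U = of_bool (i - 1 \<notin> insert 0 (fst ` G))"
    "card V = of_bool (j + 1 \<notin> insert (n + 1) (snd ` G))" "finite U" "finite V"
    by (auto simp: U_def V_def)
  have disj: "(G - {(i, j)}) \<inter> U = {}" "((G - {(i, j)}) \<union> U) \<inter> V = {}"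
    by (force simp: U_def V_def)+
  have "root_of ` int_ideal n G - {root_of (i, j)} = root_of ` (int_ideal n G - {(i, j)})"
    using root_image_diff[OF int_ideal_subset, of "{(i, j)}" n G] gi by simp
  then have "card (min_elems n (upper_ideal n (root_of ` G) - {root_of (i, j)}))
      = card (root_of ` int_min (int_ideal n G - {(i, j)}))"
    using int_ideal_subset[of n G]
    by (simp add: upper_ideal_root G) (metis Diff_subset min_elems_root order_trans)
  also have "\<dots> = card (int_min (int_ideal n G - {(i, j)}))"
    using int_ideal_subset[of n G] int_min_subset
    by (intro card_root_image[of _ n]) fast
  also have "\<dots> = card ((G - {(i, j)}) \<union> U \<union> V)"
    using int_min_ideal_remove[OF G g] by (simp add: U_def V_def)
  also have "\<dots> = card (G - {(i, j)}) + card U + card V"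
    using fin cards(3,4) disj by (simp add: card_Un_disjoint)
  also have "card (G - {(i, j)}) = card G - 1" using g fin by simp
  finally have 1: "card (min_elems n (upper_ideal n (root_of ` G) - {root_of (i, j)})) =
    card G - 1 + card U + card V" .
  have 2: "card (min_elems n (upper_ideal n (root_of ` G))) = card G"
    by (simp add: upper_ideal_root G min_elems_root int_ideal_subset int_min_ideal
        card_root_image[OF G(1)])
  \<comment> \<open>Positivity makes the natural subtraction in \<open>card G - 1\<close>
    exact.\<close>
  have "card G > 0" using g fin card_gt_0_iff by blast
  then show ?thesis unfolding OY_r_def 1 2 by (simp add: cards)
qed

text \<open>Two intervals with a common end point are comparable, so each end point determines its
  element of \<open>G\<close>, and the sum over \<open>G\<close> splits into sums over left and
  right end points.\<close>

lemma OY_number_root: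
  assumes G: "G \<subseteq> intervals n" "int_antichain G"
  shows "OY_number n (root_of ` G) =
    int (card {i \<in> fst ` G. i - 1 \<notin> insert 0 (fst ` G)}) +
    int (card {j \<in> snd ` G. j + 1 \<notin> insert (n + 1) (snd ` G)})"
proof -
  have fin: "finite G" using G(1) finite_intervals finite_subset by blast
  have inj: "inj_on fst G" "inj_on snd G"
    using antichain_eq[OF G(2)] by (auto simp: inj_on_def) (metis nat_le_linear)+
  \<comment> \<open>The value 0 set for the empty antichain agrees with the empty sum.\<close>
  have "OY_number n (root_of ` G) = (\<Sum>\<gamma>\<in>root_of ` G. OY_r n (root_of ` G) \<gamma>)"
    by (simp add: OY_number_def)
  also have "\<dots> = (\<Sum>p\<in>G. OY_r n (root_of ` G) (root_of p))"
    using inj_on_subset[OF inj_on_root G(1)] by (simp add: sum.reindex)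
  also have "\<dots> = (\<Sum>p\<in>G. of_bool (fst p - 1 \<notin> insert 0 (fst ` G)) +
      of_bool (snd p + 1 \<notin> insert (n + 1) (snd ` G)))"
    using OY_r_root[OF G] by (intro sum.cong refl) (metis prod.collapse)
  also have "\<dots> = (\<Sum>i\<in>fst ` G. of_bool (i - 1 \<notin> insert 0 (fst ` G))) +
     (\<Sum>j\<in>snd ` G. of_bool (j + 1 \<notin> insert (n + 1) (snd ` G)))"
    by (simp only: sum.distrib sum.reindex[OF inj(1)] sum.reindex[OF inj(2)] o_def)
  also have "\<dots> = int (card {i \<in> fst ` G. i - 1 \<notin> insert 0 (fst ` G)}) +
    int (card {j \<in> snd ` G. j + 1 \<notin> insert (n + 1) (snd ` G)})"
    using fin by (simp only: sum_of_bool_eq finite_imageI Int_def Collect_mem_eq mem_Collect_eq)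
  finally show ?thesis .
qed

section \<open>End points of the reversed antichain\<close>

text \<open>The set \<open>D\<close> of the overview; 0 and \<open>n + 1\<close> come from the two
  adjoined intervals.\<close>

definition diag :: "nat \<Rightarrow> (nat \<times> nat) set \<Rightarrow> nat set" where
  "diag n G = {m. m = 0 \<or> m = n + 1 \<or> (m, m) \<in> G}"

text \<open>Maximal intervals containing no element of \<open>G\<close> are the gaps between
  consecutive elements of the extended antichain. The gap after the element starting at
  \<open>i\<close> starts at \<open>i + 1\<close>, and it is empty exactly when both neighbours are
  one-point intervals at \<open>i\<close> and \<open>i + 1\<close>.\<close>

lemma fst_int_reverse:
  assumes G: "G \<subseteq> intervals n" "int_antichain G"
  shows "fst ` int_reverse n G =
    Suc ` {i \<in> insert 0 (fst ` G). \<not> (i \<in> diag n G \<and> i + 1 \<in> diag n G)}" (is "?L = ?R")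
proof
  have Gb: "1 \<le> a \<and> a \<le> b \<and> b \<le> n" if "(a, b) \<in> G" for a b
    using that G by (auto simp: intervals_def)
  show "?L \<subseteq> ?R"
  proof
    fix a assume "a \<in> ?L"
    then obtain b where m: "(a, b) \<in> int_reverse n G" by force
    then have ab: "1 \<le> a" "a \<le> b" "b \<le> n" and
      no: "\<And>c d. (c, d) \<in> G \<Longrightarrow> c < a \<or> b < d"
      by (force simp: int_reverse_def int_max_def int_ideal_def intervals_def int_le_def)+
    have "a \<notin> diag n G" using ab no[of a a] by (auto simp: diag_def)
    moreover have "a - 1 \<in> insert 0 (fst ` G)"
    proof (cases "a = 1")
      case False
      \<comment> \<open>By maximality, extending to the left must capture an element of
        \<open>G\<close>; as \<open>(a, b)\<close> contains none, that element starts at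
        \<open>a - 1\<close>.\<close>
      have "(a - 1, b) \<in> int_ideal n G"
      proof (rule ccontr)
        assume "(a - 1, b) \<notin> int_ideal n G"
        moreover have "(a - 1, b) \<in> intervals n" using ab False by (auto simp: intervals_def)
        ultimately have "(a - 1, b) = (a, b)"
          using m by (auto simp: int_reverse_def int_max_def int_le_def)
        then show False using ab by auto
      qed
      then obtain c d where cd: "(c, d) \<in> G" "a - 1 \<le> c" "d \<le> b"
        by (auto simp: int_ideal_def int_le_def)
      with no[OF cd(1)] have "c = a - 1" by auto
      with cd show ?thesis by force
    qed auto
    ultimately show "a \<in> ?R" using ab by (intro image_eqI[of _ _ "a - 1"]) auto
  qed
  show "?R \<subseteq> ?L"
  proof
    fix a assume "a \<in> ?R"
    then obtain i where i: "a = Suc i" "i \<in> insert 0 (fst ` G)"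
      and nd: "\<not> (i \<in> diag n G \<and> i + 1 \<in> diag n G)" by auto
    have i_le: "i \<le> n" using i Gb by force
    \<comment> \<open>Right end points of the extended antichain's elements that start after
      \<open>i\<close>. The least one, \<open>j\<close>, belongs to the successor;
      \<open>n + 1\<close> keeps the set non-empty.\<close>
    define J where "J = insert (n + 1) {j. \<exists>c. (c, j) \<in> G \<and> i < c}"
    define j where "j = (LEAST j. j \<in> J)"
    have jJ: "j \<in> J" unfolding j_def by (rule LeastI[of _ "n + 1"]) (simp add: J_def)
    have j_le: "j \<le> d" if "d \<in> J" for d unfolding j_def using that by (rule Least_le)
    have jn: "j \<le> n + 1" by (rule j_le) (simp add: J_def)
    have j_gt: "i < j" using jJ i_le Gb by (force simp: J_def)
    have pred: "\<exists>d. (i, d) \<in> G \<and> d < j" if "i \<noteq> 0"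
    proof -
      have "i \<in> fst ` G" using that i(2) by blast
      then obtain d where d: "(i, d) \<in> G" by force
      have "d < j"
      proof (cases "j = n + 1")
        case True then show ?thesis using Gb[OF d] by auto
      next
        case False
        then obtain c where c: "(c, j) \<in> G" "i < c" using jJ by (auto simp: J_def)
        show ?thesis using antichain_eq(1)[OF G(2) c(1) d] c(2) by linarith
      qed
      with d show ?thesis by blast
    qed
    have "i + 1 < j"
    proof (rule ccontr)
      assume "\<not> i + 1 < j"
      with j_gt have j: "j = i + 1" by auto
      \<comment> \<open>With \<open>j = i + 1\<close>, an element \<open>(c, j)\<close> with
        \<open>i < c\<close> has \<open>c = j\<close>, and an element \<open>(i, d)\<close> with
        \<open>d < j\<close> has \<open>d = i\<close>.\<close>
      have "j \<in> diag n G"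
        using jJ Gb j by (auto simp: J_def diag_def) (metis Suc_leI le_antisym)
      moreover have "i \<in> diag n G"
        using pred Gb j by (auto simp: diag_def) (metis le_antisym less_Suc_eq_le)
      ultimately show False using nd j by simp
    qed
    have "(i + 1, j - 1) \<in> intervals n - int_ideal n G"
    proof -
      have False if "(c, d) \<in> G" "i + 1 \<le> c" "d \<le> j - 1" for c d
      proof -
        have "d \<in> J" using that by (auto simp: J_def)
        then show False using j_le[of d] that \<open>i + 1 < j\<close> by simp
      qed
      with \<open>i + 1 < j\<close> jn show ?thesis
        by (auto simp: int_ideal_def intervals_def int_le_def)
    qed
    \<comment> \<open>Maximality: extending to the left swallows the element starting at
      \<open>i\<close>, extending to the right swallows the successor \<open>(c, j)\<close>, unless
      the range is left.\<close>
    moreover have "q = (i + 1, j - 1)"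
      if q: "q \<in> intervals n - int_ideal n G" "int_le (i + 1, j - 1) q" for q
    proof -
      obtain a b where ab: "q = (a, b)" by force
      have b: "1 \<le> a" "a \<le> b" "b \<le> n" using q ab by (auto simp: intervals_def)
      have le: "a \<le> i + 1" "j - 1 \<le> b" using q ab by (auto simp: int_le_def)
      have no: "\<not> (a \<le> c \<and> d \<le> b)" if "(c, d) \<in> G" for c d
        using q that ab by (force simp: int_ideal_def int_le_def)
      have "a = i + 1"
      proof (rule ccontr)
        assume "a \<noteq> i + 1"
        then have "a \<le> i" "i \<noteq> 0" using le b by auto
        then show False using pred no le by force
      qed
      moreover have "b = j - 1"
      proof (rule ccontr)
        assume "b \<noteq> j - 1"
        then have "j \<le> b" using le by auto
        then obtain c where "(c, j) \<in> G" "i < c" using jJ b by (auto simp: J_def)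
        then show False using no[of c j] le \<open>j \<le> b\<close> by auto
      qed
      ultimately show ?thesis using ab by simp
    qed
    ultimately have "(i + 1, j - 1) \<in> int_reverse n G"
      by (auto simp: int_reverse_def int_max_def)
    then show "a \<in> ?L" using i by force
  qed
qed

section \<open>Reflection of the Dynkin diagram\<close>

text \<open>The diagram automorphism of \<open>A_n\<close>, sending the point \<open>k\<close> to
  \<open>n + 1 - k\<close>. It preserves inclusion and exchanges left and right end points, which
  carries \<open>fst_int_reverse\<close> over to right end points.\<close>

definition flip :: "nat \<Rightarrow> nat \<times> nat \<Rightarrow> nat \<times> nat" where
  "flip n p = (n + 1 - snd p, n + 1 - fst p)"

lemma flip_flip: "p \<in> intervals n \<Longrightarrow> flip n (flip n p) = p"
  by (auto simp: flip_def intervals_def)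

lemma flip_intervals: "p \<in> intervals n \<Longrightarrow> flip n p \<in> intervals n"
  by (auto simp: flip_def intervals_def)

lemma int_le_flip:
  assumes "p \<in> intervals n" "q \<in> intervals n"
  shows "int_le (flip n p) (flip n q) \<longleftrightarrow> int_le p q"
  using assms by (auto simp: int_le_def flip_def intervals_def)

lemma flip_mem_image_iff:
  assumes "G \<subseteq> intervals n" "p \<in> intervals n"
  shows "flip n p \<in> flip n ` G \<longleftrightarrow> p \<in> G"
proof
  assume "flip n p \<in> flip n ` G"
  then obtain g where "g \<in> G" "flip n p = flip n g" by blast
  with assms show "p \<in> G" using flip_flip by (metis subsetD)
qed simp

lemma flip_image_mem_iff:
  assumes "G \<subseteq> intervals n" "p \<in> intervals n"
  shows "p \<in> flip n ` G \<longleftrightarrow> flip n p \<in> G"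
  using flip_mem_image_iff[OF assms(1) flip_intervals[OF assms(2)]] assms(2) by (simp add: flip_flip)

lemma int_antichain_flip:
  assumes "G \<subseteq> intervals n" "int_antichain G"
  shows "int_antichain (flip n ` G)"
proof -
  have [simp]: "q \<in> intervals n" if "q \<in> G" for q using that assms by blast
  show ?thesis
    using assms(2) by (auto simp: int_antichain_def int_le_flip)
qed

lemma flip_mem_ideal_iff:
  assumes "G \<subseteq> intervals n" "p \<in> intervals n"
  shows "flip n p \<in> int_ideal n (flip n ` G) \<longleftrightarrow> p \<in> int_ideal n G"
proof -
  have [simp]: "q \<in> intervals n" if "q \<in> G" for q using that assms by blast
  show ?thesis
    using assms(2) by (auto simp: int_ideal_def int_le_flip flip_intervals)
qed

text \<open>The reverse operator is built from inclusion alone, and \<open>flip\<close> is an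
  involution of the intervals preserving it; the quantifier over intervals is reindexed along
  \<open>flip\<close>.\<close>

lemma flip_mem_reverse_iff:
  assumes "G \<subseteq> intervals n" "p \<in> intervals n"
  shows "flip n p \<in> int_reverse n (flip n ` G) \<longleftrightarrow> p \<in> int_reverse n G"
proof -
  have all: "(\<forall>q\<in>intervals n. P q) \<longleftrightarrow> (\<forall>q\<in>intervals n. P (flip n q))" for P
  proof
    assume r: "\<forall>q\<in>intervals n. P (flip n q)"
    show "\<forall>q\<in>intervals n. P q"
    proof
      fix q assume q: "q \<in> intervals n"
      show "P q" using bspec[OF r flip_intervals[OF q]] q by (simp add: flip_flip)
    qed
  qed (simp add: flip_intervals)
  have eq: "flip n q = flip n p \<longleftrightarrow> q = p" if "q \<in> intervals n" for q
    using flip_flip assms(2) that by metis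
  have "flip n p \<in> int_reverse n (flip n ` G) \<longleftrightarrow>
    flip n p \<notin> int_ideal n (flip n ` G) \<and>
    (\<forall>q\<in>intervals n. q \<notin> int_ideal n (flip n ` G) \<longrightarrow> int_le (flip n p) q \<longrightarrow> q = flip n p)"
    using assms(2) by (auto simp: int_reverse_def int_max_def flip_intervals)
  also have "\<dots> \<longleftrightarrow> p \<notin> int_ideal n G \<and>
    (\<forall>q\<in>intervals n. q \<notin> int_ideal n G \<longrightarrow> int_le p q \<longrightarrow> q = p)"
    using assms by (subst all) (simp add: flip_mem_ideal_iff int_le_flip eq)
  also have "\<dots> \<longleftrightarrow> p \<in> int_reverse n G"
    using assms(2) by (auto simp: int_reverse_def int_max_def)
  finally show ?thesis .
qed

lemma fst_image_flip:
  assumes "G \<subseteq> intervals n" "j \<in> {1..n}"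
  shows "n + 1 - j \<in> fst ` flip n ` G \<longleftrightarrow> j \<in> snd ` G"
proof
  assume "n + 1 - j \<in> fst ` flip n ` G"
  then obtain a b where ab: "(a, b) \<in> G" "n + 1 - j = n + 1 - b" by (auto simp: flip_def)
  then have "b \<le> n" using assms(1) by (auto simp: intervals_def)
  with ab assms(2) have "b = j" by auto
  with ab show "j \<in> snd ` G" by force
next
  assume "j \<in> snd ` G"
  then show "n + 1 - j \<in> fst ` flip n ` G" by (force simp: flip_def)
qed

text \<open>The reflection exchanges the adjoined points 0 and \<open>n + 1\<close>, so the range
  reaches up to \<open>n + 1\<close>.\<close>

lemma diag_flip:
  assumes "G \<subseteq> intervals n" "m \<le> n + 1"
  shows "n + 1 - m \<in> diag n (flip n ` G) \<longleftrightarrow> m \<in> diag n G"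
proof (cases "m \<in> {1..n}")
  case True
  then have "(m, m) \<in> intervals n" by (auto simp: intervals_def)
  from flip_mem_image_iff[OF assms(1) this] True show ?thesis
    by (auto simp: diag_def flip_def)
next
  case False
  then have "m = 0 \<or> m = n + 1" using assms(2) by auto
  then show ?thesis by (auto simp: diag_def)
qed

text \<open>The mirror image of \<open>fst_int_reverse\<close>: a gap ends just before the right end
  point of its right neighbour. Reflection handles \<open>j\<close> in \<open>{1..n}\<close>; both
  sides are then shown to lie in that range.\<close>

lemma snd_int_reverse:
  assumes G: "G \<subseteq> intervals n" "int_antichain G"
  shows "snd ` int_reverse n G =
    {j. j + 1 \<in> insert (n + 1) (snd ` G) \<and> \<not> (j \<in> diag n G \<and> j + 1 \<in> diag n G)}"
proof -
  have iff: "j \<in> snd ` int_reverse n G \<longleftrightarrow>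
      j + 1 \<in> insert (n + 1) (snd ` G) \<and> \<not> (j \<in> diag n G \<and> j + 1 \<in> diag n G)"
    if j: "j \<in> {1..n}" for j
  proof -
    have "flip n ` int_reverse n G = int_reverse n (flip n ` G)"
    proof (rule set_eqI)
      fix p
      show "p \<in> flip n ` int_reverse n G \<longleftrightarrow> p \<in> int_reverse n (flip n ` G)"
      proof (cases "p \<in> intervals n")
        case True
        then show ?thesis
          using flip_mem_reverse_iff[OF G(1) flip_intervals[OF True]]
          by (simp add: flip_image_mem_iff int_reverse_subset flip_flip)
      next
        case False
        then show ?thesis using int_reverse_subset flip_intervals by blast
      qed
    qed
    then have "j \<in> snd ` int_reverse n G \<longleftrightarrow> n + 1 - j \<in> fst ` int_reverse n (flip n ` G)"
      using fst_image_flip[OF int_reverse_subset j, of G] by simp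
    \<comment> \<open>Here \<open>n + 1 - j\<close> is the successor of \<open>n - j\<close>, and
      \<open>n - j\<close> is the reflection of \<open>j + 1\<close>.\<close>
    also have "\<dots> \<longleftrightarrow> n - j \<in> insert 0 (fst ` flip n ` G) \<and>
      \<not> (n - j \<in> diag n (flip n ` G) \<and> n + 1 - j \<in> diag n (flip n ` G))"
      using j flip_intervals G
      by (subst fst_int_reverse) (auto simp: int_antichain_flip Suc_diff_le subset_iff)
    also have "n - j \<in> diag n (flip n ` G) \<longleftrightarrow> j + 1 \<in> diag n G"
      using diag_flip[OF G(1), of "j + 1"] j by simp
    also have "n + 1 - j \<in> diag n (flip n ` G) \<longleftrightarrow> j \<in> diag n G"
      using diag_flip[OF G(1), of j] j by simp
    also have "n - j \<in> insert 0 (fst ` flip n ` G) \<longleftrightarrow> j + 1 \<in> insert (n + 1) (snd ` G)"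
    proof (cases "j = n")
      case False
      then have "0 < n - j" "j + 1 \<noteq> n + 1" using j by auto
      then show ?thesis using fst_image_flip[OF G(1), of "j + 1"] j by auto
    qed simp
    finally show ?thesis by blast
  qed
  have "j \<in> {1..n}" if "j \<in> snd ` int_reverse n G" for j
    using that int_reverse_subset[of n G] by (force simp: intervals_def)
  moreover have "j \<in> {1..n}"
    if "j + 1 \<in> insert (n + 1) (snd ` G)" "\<not> (j \<in> diag n G \<and> j + 1 \<in> diag n G)" for j
  proof -
    \<comment> \<open>A right end point 1 belongs to the one-point interval at 1 or is the adjoined
      \<open>n + 1\<close>; then 0 and 1 are both in \<open>diag n G\<close>.\<close>
    have "j \<noteq> 0"
    proof
      assume "j = 0"
      then have "1 \<in> diag n G"
        using that(1) G(1) by (force simp: diag_def intervals_def)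
      then show False using that(2) \<open>j = 0\<close> by (simp add: diag_def)
    qed
    moreover have "j \<le> n" using that(1) G(1) by (force simp: intervals_def)
    ultimately show ?thesis by simp
  qed
  ultimately show ?thesis using iff by blast
qed

section \<open>The two changes cancel\<close>

text \<open>An element starting at \<open>i - 1\<close> must end before the one-point interval at
  \<open>i\<close>, so it is itself a one-point interval; for \<open>i = 1\<close> the adjoined 0
  takes its place. \<open>diag_succ\<close> is the mirror image.\<close>

lemma diag_pred:
  assumes G: "G \<subseteq> intervals n" "int_antichain G"
    and i: "i \<in> diag n G" "1 \<le> i" "i \<le> n" "i - 1 \<in> insert 0 (fst ` G)"
  shows "i - 1 \<in> diag n G"
proof (cases "i = 1")
  case False
  then obtain d where d: "(i - 1, d) \<in> G" using i by force
  have "(i, i) \<in> G" using i by (auto simp: diag_def)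
  then have "d < i" using antichain_eq(1)[OF G(2) _ d, of i i] i by force
  moreover have "i - 1 \<le> d" using d G by (auto simp: intervals_def)
  ultimately have "d = i - 1" by auto
  with d show ?thesis by (simp add: diag_def)
qed (simp add: diag_def)

lemma diag_succ:
  assumes G: "G \<subseteq> intervals n" "int_antichain G"
    and j: "j \<in> diag n G" "1 \<le> j" "j \<le> n" "j + 1 \<in> insert (n + 1) (snd ` G)"
  shows "j + 1 \<in> diag n G"
proof (cases "j = n")
  case False
  then obtain c where c: "(c, j + 1) \<in> G" using j by force
  have "(j, j) \<in> G" using j by (auto simp: diag_def)
  then have "j < c" using antichain_eq(2)[OF G(2) _ c, of j j] by force
  moreover have "c \<le> j + 1" using c G by (auto simp: intervals_def)
  ultimately have "c = j + 1" by auto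
  with c show ?thesis by (simp add: diag_def)
qed (simp add: diag_def)

lemma card_Diff_Un_int:
  assumes "finite S" "finite T" "F \<subseteq> S" "T \<inter> S = {}"
  shows "int (card ((S - F) \<union> T)) = int (card S) - int (card F) + int (card T)"
proof -
  have "finite F" using assms finite_subset by blast
  have "card ((S - F) \<union> T) = card (S - F) + card T"
    using assms by (intro card_Un_disjoint) auto
  moreover have "card (S - F) = card S - card F" "card F \<le> card S"
    using assms \<open>finite F\<close> by (auto intro: card_Diff_subset card_mono)
  ultimately show ?thesis by simp
qed

text \<open>Up to a shift by one, the counted left end points pass from \<open>S1\<close> to
  \<open>(S1 - F) \<union> T\<close>, the right ones from \<open>S2\<close> to
  \<open>(S2 - T) \<union> F\<close>. The two sets \<open>F\<close> and \<open>T\<close> may differ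
  in size; each cancels against itself in the total.\<close>

lemma OY_number_reverse:
  assumes G: "G \<subseteq> intervals n" "int_antichain G"
  shows "OY_number n (root_of ` int_reverse n G) = OY_number n (root_of ` G)"
proof -
  define D where "D = diag n G"
  define A where "A = fst ` G"
  define B where "B = snd ` G"
  define A' where "A' = fst ` int_reverse n G"
  define B' where "B' = snd ` int_reverse n G"
  \<comment> \<open>\<open>F\<close> collects the first and \<open>T\<close> the last points, within
    \<open>{1..n}\<close>, of runs of at least two elements of \<open>D\<close>.\<close>
  define F where "F = {m \<in> {1..n}. m - 1 \<notin> D \<and> m \<in> D \<and> m + 1 \<in> D}"
  define T where "T = {m \<in> {1..n}. m - 1 \<in> D \<and> m \<in> D \<and> m + 1 \<notin> D}"
  define S1 where "S1 = {i \<in> A. i - 1 \<notin> insert 0 A}"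
  define S2 where "S2 = {j \<in> B. j + 1 \<notin> insert (n + 1) B}"
  have AB: "A \<subseteq> {1..n}" "B \<subseteq> {1..n}"
    using G(1) by (force simp: A_def B_def intervals_def)+
  have D: "0 \<in> D" "n + 1 \<in> D" by (auto simp: D_def diag_def)
  have DAB: "m \<in> A" "m \<in> B" if "m \<in> D" "1 \<le> m" "m \<le> n" for m
    using that by (force simp: D_def diag_def A_def B_def)+
  have pred: "i - 1 \<in> D" if "i \<in> D" "1 \<le> i" "i \<le> n" "i - 1 \<in> insert 0 A" for i
    using diag_pred[OF G] that by (simp add: D_def A_def)
  have succ: "j + 1 \<in> D" if "j \<in> D" "1 \<le> j" "j \<le> n" "j + 1 \<in> insert (n + 1) B" for j
    using diag_succ[OF G] that by (simp add: D_def B_def)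
  have A': "A' = Suc ` {i \<in> insert 0 A. \<not> (i \<in> D \<and> i + 1 \<in> D)}"
    unfolding A'_def A_def D_def by (rule fst_int_reverse[OF G])
  have B': "B' = {j. j + 1 \<in> insert (n + 1) B \<and> \<not> (j \<in> D \<and> j + 1 \<in> D)}"
    unfolding B'_def B_def D_def by (rule snd_int_reverse[OF G])
  have fin: "finite S1" "finite S2" "finite F" "finite T"
    using AB finite_subset[of _ "{1..n}"] by (auto simp: S1_def S2_def F_def T_def)

  \<comment> \<open>At a run start, \<open>m - 1\<close> is not in \<open>A\<close> or 0, since
    \<open>pred\<close> would put it into \<open>D\<close>. At a run end, \<open>m - 1\<close> is in
    \<open>D\<close>, hence in \<open>A\<close> or 0, which gives \<open>T1\<close>. The claims for
    \<open>S2\<close> are symmetric.\<close>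
  have F1: "F \<subseteq> S1"
  proof
    fix m assume "m \<in> F"
    then show "m \<in> S1" using pred[of m] DAB[of m] by (auto simp: F_def S1_def)
  qed
  have T2: "T \<subseteq> S2"
  proof
    fix m assume "m \<in> T"
    then show "m \<in> S2" using succ[of m] DAB[of m] by (auto simp: T_def S2_def)
  qed
  have T1: "T \<inter> S1 = {}"
  proof -
    have "m - 1 \<in> insert 0 A" if "m \<in> T" for m
      using that DAB(1)[of "m - 1"] by (cases "m - 1 = 0") (auto simp: T_def)
    then show ?thesis by (auto simp: S1_def)
  qed
  have F2: "F \<inter> S2 = {}"
  proof -
    have "m + 1 \<in> insert (n + 1) B" if "m \<in> F" for m
      using that DAB(2)[of "m + 1"] by (cases "m = n") (auto simp: F_def)
    then show ?thesis by (auto simp: S2_def)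
  qed

  have "{x \<in> A'. x - 1 \<notin> insert 0 A'} = Suc ` ((S1 - F) \<union> T)"
  proof -
    \<comment> \<open>\<open>i \<notin> A'\<close> has two causes: either \<open>i - 1\<close> is
      not in \<open>insert 0 A\<close>, giving \<open>S1 - F\<close>, or \<open>i - 1\<close> and
      \<open>i\<close> are both in \<open>D\<close>, giving \<open>T\<close>.\<close>
    have "i \<in> A \<and> \<not> (i \<in> D \<and> i + 1 \<in> D) \<and> i \<notin> A' \<longleftrightarrow> i \<in> (S1 - F) \<union> T" for i
    proof (cases "i \<in> {1..n}")
      case True
      then have "i \<in> A' \<longleftrightarrow> i - 1 \<in> insert 0 A \<and> \<not> (i - 1 \<in> D \<and> i \<in> D)"
        unfolding A' by (cases i) auto
      moreover have "i - 1 \<in> insert 0 A" if "i - 1 \<in> D"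
        using DAB(1)[OF that] True by (cases "i - 1 = 0") auto
      ultimately show ?thesis
        using True pred[of i] DAB(1)[of i] by (auto simp: S1_def F_def T_def)
    next
      case False
      then show ?thesis using AB by (auto simp: S1_def T_def)
    qed
    moreover have "i \<noteq> 0" if "i \<in> A" for i using that AB by auto
    moreover have "i \<noteq> 0" if "i \<in> (S1 - F) \<union> T" for i
      using that AB by (auto simp: S1_def T_def)
    \<comment> \<open>The point \<open>x = 1\<close>, which comes from the adjoined 0, is discarded
      because \<open>x - 1\<close> is then 0.\<close>
    moreover have "x \<in> A' \<and> x - 1 \<notin> insert 0 A' \<longleftrightarrow>
      (\<exists>i. x = Suc i \<and> i \<in> A \<and> \<not> (i \<in> D \<and> i + 1 \<in> D) \<and> i \<notin> A' \<and> i \<noteq> 0)" for x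
      by (subst (1) A') auto
    ultimately show ?thesis by blast
  qed
  then have c1: "card {x \<in> A'. x - 1 \<notin> insert 0 A'} = card ((S1 - F) \<union> T)"
    by (simp add: card_image)

  have "bij_betw Suc {x \<in> B'. x + 1 \<notin> insert (n + 1) B'} ((S2 - T) \<union> F)"
  proof -
    \<comment> \<open>The same analysis at \<open>Suc x\<close>: it is missing from
      \<open>B'\<close> because \<open>x + 2\<close> is not in \<open>insert (n + 1) B\<close>,
      giving \<open>S2 - T\<close>, or because \<open>x + 1\<close> and \<open>x + 2\<close> are
      both in \<open>D\<close>, giving \<open>F\<close>.\<close>
    have "Suc x \<in> (S2 - T) \<union> F \<longleftrightarrow> x \<in> B' \<and> x + 1 \<notin> insert (n + 1) B'" for x
    proof (cases "Suc x \<in> {1..n}")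
      case True
      then show ?thesis
        using succ[of "Suc x"] DAB(2)[of "Suc x"] DAB(2)[of "x + 2"] D
        by (cases "Suc x = n") (auto simp: S2_def F_def T_def B')
    next
      case False
      then show ?thesis using AB by (auto simp: S2_def F_def B')
    qed
    moreover have "0 \<notin> (S2 - T) \<union> F" using AB by (auto simp: S2_def F_def)
    ultimately have "y \<in> (S2 - T) \<union> F \<longleftrightarrow> y \<in> Suc ` {x \<in> B'. x + 1 \<notin> insert (n + 1) B'}" for y
      by (cases y) blast+
    then have "(S2 - T) \<union> F = Suc ` {x \<in> B'. x + 1 \<notin> insert (n + 1) B'}"
      by blast
    then show ?thesis by (simp add: bij_betw_def)
  qed
  then have c2: "card {x \<in> B'. x + 1 \<notin> insert (n + 1) B'} = card ((S2 - T) \<union> F)"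
    by (rule bij_betw_same_card)

  have "OY_number n (root_of ` int_reverse n G) =
    int (card {x \<in> A'. x - 1 \<notin> insert 0 A'}) + int (card {x \<in> B'. x + 1 \<notin> insert (n + 1) B'})"
    using OY_number_root[OF int_reverse_subset int_antichain_reverse]
    by (simp only: A'_def B'_def)
  also have "\<dots> = int (card S1) + int (card S2)"
    unfolding c1 c2 card_Diff_Un_int[OF fin(1,4) F1 T1] card_Diff_Un_int[OF fin(2,3) T2 F2] by simp
  also have "\<dots> = OY_number n (root_of ` G)"
    using OY_number_root[OF G] by (simp only: S1_def S2_def A_def B_def)
  finally show ?thesis .
qed

theorem mainTheorem2:
  fixes n :: nat and \<Gamma> :: "(nat \<Rightarrow> real) set"
  assumes "n \<ge> 1" and "\<Gamma> \<in> antichains n"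
  shows "OY_number n \<Gamma> = OY_number n (reverse_op n \<Gamma>)"
proof -
  obtain G where "G \<subseteq> intervals n" "int_antichain G" "\<Gamma> = root_of ` G"
    using antichains_root[OF assms(2)] by blast
  then show ?thesis
    by (simp add: reverse_op_root OY_number_reverse)
qed

end
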